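(* Let $(y_i,x_i)$, $i=1,\dots,n$, $y_i\in\mathbb{R}^q$, $x_i\in\mathbb{R}^p$, be data, let $\rho_1$ be a differentiable $\rho$-function with $\psi_1=\rho_1'$ and $W(u)=\psi_1(u)/u$, and let $\hat\sigma_n>0$ be a fixed scale. Consider the iteration: start with $B^{(0)}\in\mathbb{R}^{p\times q}$ and $\Sigma^{(0)}=\hat\sigma_n^2\Gamma^{(0)}$ with $\Gamma^{(0)}\in\mathcal{S}_q$, $|\Gamma^{(0)}|=1$; given $(B^{(k)},\Sigma^{(k)})$, set $\omega_{ik}=W(d_i(B^{(k)},\Sigma^{(k)}))$, let $B^{(k+1)}$ be the weighted least squares fit obtained by computing each column of $B$ separately by weighted least squares with weights $\omega_{ik}$ (i.e. $B^{(k+1)}$ minimizes $\sum_i\omega_{ik}\|y_i-B'x_i\|^2$), let $C^{(k+1)}=\sum_{i=1}^n\omega_{ik}(y_i-B^{(k+1)\prime}x_i)(y_i-B^{(k+1)\prime}x_i)'$ and $\Sigma^{(k+1)}=\hat\sigma_n^2C^{(k+1)}/|C^{(k+1)}|^{1/q}$. If $W(u)$ is nonincreasing in $|u|$, then at each iteration the function $\sum_{i=1}^n\rho_1(d_i(B^{(k)},\Sigma^{(k)}))$ is nonincreasing in $k$.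
   Context: $\mathcal{S}_q$ is the set of positive definite symmetric $q\times q$ matrices, $|\cdot|$ the determinant. A $\rho$-function is a continuous nondecreasing function of $|u|$ with $\rho(0)=0$, $\sup\rho=1$, strictly increasing on nonnegative $u$ with $\rho(u)<1$. $d_i(B,\Sigma)=((y_i-B'x_i)'\Sigma^{-1}(y_i-B'x_i))^{1/2}$. In the paper $B^{(0)},\Gamma^{(0)}$ are initial estimates $\tilde B_n,\tilde\Sigma_n$ (with $|\tilde\Sigma_n|=1$) and $\hat\sigma_n$ is the M-scale of the Mahalanobis norms $d_i(\tilde B_n,\tilde\Sigma_n)$. *)

theory Defs
  imports "HOL-Analysis.Analysis"
begin

definition rho_function :: "(real \<Rightarrow> real) \<Rightarrow> bool" where
  "rho_function \<rho> \<longleftrightarrow>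
     continuous_on UNIV \<rho> \<and>
     (\<forall>u. \<rho> u = \<rho> \<bar>u\<bar>) \<and>
     (\<forall>u v. 0 \<le> u \<longrightarrow> u \<le> v \<longrightarrow> \<rho> u \<le> \<rho> v) \<and>
     \<rho> 0 = 0 \<and>
     bdd_above (range \<rho>) \<and> (SUP u. \<rho> u) = 1 \<and>
     (\<forall>u v. 0 \<le> u \<longrightarrow> u < v \<longrightarrow> \<rho> u < 1 \<longrightarrow> \<rho> u < \<rho> v)"

definition pos_def_sym :: "real^'q^'q \<Rightarrow> bool" where
  "pos_def_sym S \<longleftrightarrow> transpose S = S \<and> (\<forall>v. v \<noteq> 0 \<longrightarrow> v \<bullet> (S *v v) > 0)"

definition resid :: "real^'q \<Rightarrow> real^'p \<Rightarrow> real^'q^'p \<Rightarrow> real^'q" where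
  "resid yi xi B = yi - xi v* B"

definition mahal :: "real^'q \<Rightarrow> real^'p \<Rightarrow> real^'q^'p \<Rightarrow> real^'q^'q \<Rightarrow> real" where
  "mahal yi xi B S = sqrt (resid yi xi B \<bullet> (matrix_inv S *v resid yi xi B))"

definition outer :: "real^'q \<Rightarrow> real^'q^'q" where
  "outer r = (\<chi> a b. r $ a * r $ b)"

definition wscatter :: "nat \<Rightarrow> (nat \<Rightarrow> real^'q) \<Rightarrow> (nat \<Rightarrow> real^'p) \<Rightarrow> real^'q^'p
     \<Rightarrow> (nat \<Rightarrow> real) \<Rightarrow> real^'q^'q" where
  "wscatter n y x B w = (\<Sum>i<n. w i *\<^sub>R outer (resid (y i) (x i) B))"

end

theory Submission
  imports Defs
begin

text \<open>
  Since \<open>W\<close> is nonincreasing, the loss is majorized at each old distance by a parabola in the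
  distance: \<open>\<rho>1 v - \<rho>1 u \<le> W u * (v\<^sup>2 - u\<^sup>2) / 2\<close>. So it suffices that the weighted sum of squared
  distances does not increase when the weights are held fixed. In the \<open>B\<close>-step this is least squares:
  the normal equations do not depend on the metric, so the ordinary least squares fit also minimizes
  the weighted sum of squares for every inner product. In the \<open>\<Sigma>\<close>-step the sum is the trace of
  \<open>\<Sigma>\<^sup>-\<^sup>1 C\<close>, and for matrices of fixed determinant the inequality of arithmetic and geometric means
  for the eigenvalues of \<open>\<Sigma>\<^sup>-\<^sup>1 C\<close> shows that it is least when \<open>\<Sigma>\<close> is proportional to \<open>C\<close>.
\<close>

section \<open>First-order conditions and symmetric forms\<close>

text \<open>Near 0 a nonzero linear term dominates the quadratic one and takes both signs. This
  supplies the first-order condition for quadratic forms as well as for least squares.\<close>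

lemma linear_coeff_eq_0:
  fixes b c :: real
  assumes "\<And>t. 0 \<le> t * b + t\<^sup>2 * c"
  shows "b = 0"
proof (rule ccontr)
  assume b: "b \<noteq> 0"
  \<comment> \<open>With this choice \<open>b = - t * (1 + \<bar>c\<bar>)\<close>, so the upper
    bound on the next line collapses to minus the square of \<open>t\<close>.\<close>
  define t where "t = - b / (1 + \<bar>c\<bar>)"
  have "t * b + t\<^sup>2 * c \<le> t * b + t\<^sup>2 * \<bar>c\<bar>"
    by (intro add_left_mono mult_left_mono) auto
  also have "\<dots> = - t\<^sup>2"
  proof -
    have b': "b = - (t * (1 + \<bar>c\<bar>))" by (simp add: t_def)
    have "t * b = - (t\<^sup>2 * (1 + \<bar>c\<bar>))"
      by (subst b') (simp add: power2_eq_square)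
    then show ?thesis by (simp add: algebra_simps)
  qed
  also have "\<dots> < 0"
    using b by (simp add: t_def add_nonneg_eq_0_iff)
  finally show False using assms[of t] by linarith
qed

lemma symmetric_matrix_inner:
  fixes S :: "real^'q^'q"
  assumes "transpose S = S"
  shows "w \<bullet> (S *v v) = v \<bullet> (S *v w)"
  by (metis assms dot_lmul_matrix inner_commute vector_transpose_matrix)

lemma pos_def_sym_invertible:
  fixes S :: "real^'q^'q"
  assumes "pos_def_sym S"
  shows "invertible S"
proof -
  have "S *v v \<noteq> 0" if "v \<noteq> 0" for v
    using assms that unfolding pos_def_sym_def by force
  then show ?thesis
    by (metis invertible_left_inverse matrix_left_invertible_ker)
qed

text \<open>The form attains its minimum 0 over \<open>V\<close> at \<open>v\<close>, so its
  derivative at \<open>v\<close> along each direction \<open>w\<close> of \<open>V\<close>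
  vanishes.\<close>

lemma psd_inner_eq_0:
  fixes N :: "real^'q^'q"
  assumes sym: "transpose N = N" and V: "subspace V"
    and psd: "\<And>w. w \<in> V \<Longrightarrow> 0 \<le> w \<bullet> (N *v w)"
    and v: "v \<in> V" "v \<bullet> (N *v v) = 0" and w: "w \<in> V"
  shows "w \<bullet> (N *v v) = 0"
proof -
  have "0 \<le> t * (2 * (w \<bullet> (N *v v))) + t\<^sup>2 * (w \<bullet> (N *v w))" for t
  proof -
    have "v + t *\<^sub>R w \<in> V"
      using V v w by (simp add: subspace_add subspace_scale)
    then have "0 \<le> (v + t *\<^sub>R w) \<bullet> (N *v (v + t *\<^sub>R w))" by (rule psd)
    also have "\<dots> = t * (2 * (w \<bullet> (N *v v))) + t\<^sup>2 * (w \<bullet> (N *v w))"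
      using v(2) symmetric_matrix_inner[OF sym, of v w]
      by (simp add: algebra_simps inner_add_left inner_add_right matrix_vector_right_distrib
          matrix_vector_mult_scaleR power2_eq_square)
    finally show ?thesis .
  qed
  from linear_coeff_eq_0[OF this] show ?thesis by simp
qed

section \<open>Simultaneous diagonalization of two symmetric forms\<close>

text \<open>The quotient of the two forms is invariant under scaling, so its maximum on the compact
  unit sphere of \<open>V\<close> is its maximum on all nonzero vectors of \<open>V\<close>. The
  vector \<open>z\<close> makes that sphere nonempty.\<close>

lemma rayleigh_quotient_max:
  fixes S C :: "real^'q^'q"
  assumes S: "pos_def_sym S" and V: "subspace V" and z: "z \<in> V" "z \<noteq> 0"
  obtains v m where "v \<in> V" "v \<bullet> (S *v v) = 1" "v \<bullet> (C *v v) = m"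
    "\<And>w. w \<in> V \<Longrightarrow> w \<bullet> (C *v w) \<le> m * (w \<bullet> (S *v w))"
proof -
  define K where "K = sphere 0 1 \<inter> V"
  have pd: "0 < v \<bullet> (S *v v)" if "v \<noteq> 0" for v
    using S that by (simp add: pos_def_sym_def)
  have K0: "v \<noteq> 0" if "v \<in> K" for v using that by (auto simp: K_def)
  have "compact K"
    using closed_subspace[OF V] by (auto simp: K_def intro: compact_Int_closed)
  moreover have "(1 / norm z) *\<^sub>R z \<in> K"
    using z V by (simp add: K_def subspace_scale)
  moreover have "continuous_on K (\<lambda>v. (v \<bullet> (C *v v)) / (v \<bullet> (S *v v)))"
    using pd K0
    by (intro continuous_intros linear_continuous_on_compose matrix_vector_mul_linear) force
  ultimately obtain u where u: "u \<in> K"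
    and umax: "\<And>w. w \<in> K \<Longrightarrow> (w \<bullet> (C *v w)) / (w \<bullet> (S *v w)) \<le> (u \<bullet> (C *v u)) / (u \<bullet> (S *v u))"
    by (metis (no_types, lifting) continuous_attains_sup empty_iff)
  define m where "m = (u \<bullet> (C *v u)) / (u \<bullet> (S *v u))"
  define s where "s = u \<bullet> (S *v u)"
  have s: "s > 0" using pd K0 u by (simp add: s_def)
  show thesis
  proof
    \<comment> \<open>Rescaling normalizes the maximizer with respect to \<open>S\<close> and leaves
      the quotient \<open>m\<close> unchanged.\<close>
    show "(1 / sqrt s) *\<^sub>R u \<in> V" using u V by (simp add: K_def subspace_scale)
    show "((1 / sqrt s) *\<^sub>R u) \<bullet> (S *v ((1 / sqrt s) *\<^sub>R u)) = 1"
      using s by (simp add: matrix_vector_mult_scaleR flip: s_def)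
    show "((1 / sqrt s) *\<^sub>R u) \<bullet> (C *v ((1 / sqrt s) *\<^sub>R u)) = m"
      using s by (simp add: matrix_vector_mult_scaleR m_def flip: s_def)
    fix w assume w: "w \<in> V"
    show "w \<bullet> (C *v w) \<le> m * (w \<bullet> (S *v w))"
    proof (cases "w = 0")
      case False
      then have "(1 / norm w) *\<^sub>R w \<in> K" using w V by (simp add: K_def subspace_scale)
      from umax[OF this] have "(w \<bullet> (C *v w)) / (w \<bullet> (S *v w)) \<le> m"
        using False by (simp add: matrix_vector_mult_scaleR m_def)
      then show ?thesis using pd[OF False] by (simp add: divide_le_eq)
    qed simp
  qed
qed

text \<open>
  On the \<open>S\<close>-orthogonal complement \<open>V\<close> of the eigenvectors already found, the form of
  \<open>N = m S - C\<close> is nonnegative and vanishes at a maximizer \<open>v\<close> of the Rayleigh quotient, so \<open>N v\<close> is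
  orthogonal to \<open>V\<close>; it is orthogonal to the earlier eigenvectors because \<open>N\<close> is symmetric.
\<close>

lemma generalized_eigenvector_orthogonal:
  fixes S C :: "real^'q^'q"
  assumes S: "pos_def_sym S" and C: "transpose C = C" and "finite I" "card I < CARD('q)"
    and eig: "\<And>i. i \<in> I \<Longrightarrow> C *v e i = l i *\<^sub>R (S *v e i)"
    and orth: "\<And>i j. i \<in> I \<Longrightarrow> j \<in> I \<Longrightarrow> e i \<bullet> (S *v e j) = (if i = j then 1 else 0)"
  obtains v m where "v \<bullet> (S *v v) = 1" "C *v v = m *\<^sub>R (S *v v)" "\<And>i. i \<in> I \<Longrightarrow> v \<bullet> (S *v e i) = 0"
proof -
  define V where "V = {v. \<forall>i\<in>I. v \<bullet> (S *v e i) = 0}"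
  have Ssym: "transpose S = S" using S by (simp add: pos_def_sym_def)
  have V: "subspace V" by (auto simp: V_def subspace_def inner_add_left)
  \<comment> \<open>Dimension count: fewer than \<open>CARD('q)\<close> vectors do not span, so
    \<open>V\<close> contains a nonzero vector.\<close>
  have "dim ((\<lambda>i. S *v e i) ` I) \<le> card ((\<lambda>i. S *v e i) ` I)"
    using \<open>finite I\<close> by (intro dim_le_card') simp
  also have "\<dots> \<le> card I" using \<open>finite I\<close> by (rule card_image_le)
  also have "\<dots> < DIM(real^'q)" using assms(4) by simp
  finally obtain z where z: "z \<noteq> 0"
    "\<And>w. w \<in> span ((\<lambda>i. S *v e i) ` I) \<Longrightarrow> orthogonal z w"
    by (rule orthogonal_to_subspace_exists) blast
  then have "z \<in> V" by (auto simp: V_def orthogonal_def intro: span_base)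
  from rayleigh_quotient_max[OF S V this z(1)] obtain v m
    where v: "v \<in> V" "v \<bullet> (S *v v) = 1" "v \<bullet> (C *v v) = m"
      and max: "\<And>w. w \<in> V \<Longrightarrow> w \<bullet> (C *v w) \<le> m * (w \<bullet> (S *v w))"
    by metis
  define N where "N = m *\<^sub>R S - C"
  have Nv: "N *v w = m *\<^sub>R (S *v w) - C *v w" for w
    by (simp add: N_def matrix_vector_mult_diff_rdistrib scaleR_matrix_vector_assoc)
  have Nsym: "transpose N = N"
  proof -
    have "transpose N = m *\<^sub>R transpose S - transpose C"
      by (simp add: N_def transpose_def vec_eq_iff)
    then show ?thesis by (simp add: Ssym C N_def)
  qed
  have NV: "w \<bullet> (N *v v) = 0" if "w \<in> V" for w
  proof (rule psd_inner_eq_0[OF Nsym V _ v(1) _ that])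
    show "0 \<le> u \<bullet> (N *v u)" if "u \<in> V" for u
      using max[OF that] by (simp add: Nv inner_diff_right)
    show "v \<bullet> (N *v v) = 0"
      using v(2,3) by (simp add: Nv inner_diff_right)
  qed
  have Ne: "e i \<bullet> (N *v v) = 0" if "i \<in> I" for i
  proof -
    have "v \<bullet> (S *v e i) = 0" using v(1) that by (simp add: V_def)
    then have "v \<bullet> (N *v e i) = 0"
      unfolding Nv inner_diff_right eig[OF that] by simp
    then show ?thesis by (metis symmetric_matrix_inner[OF Nsym])
  qed
  have "w \<bullet> (N *v v) = 0" for w
  proof -
    \<comment> \<open>\<open>p\<close> is the \<open>S\<close>-orthogonal projection of
      \<open>w\<close> onto the span of the earlier eigenvectors. Since \<open>N *v v\<close> is
      orthogonal both to that span and to \<open>V\<close>, it is orthogonal to every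
      \<open>w\<close>.\<close>
    define p where "p = (\<Sum>i\<in>I. (w \<bullet> (S *v e i)) *\<^sub>R e i)"
    have "p \<bullet> (S *v e j) = w \<bullet> (S *v e j)" if "j \<in> I" for j
    proof -
      have "p \<bullet> (S *v e j) = (\<Sum>i\<in>I. (w \<bullet> (S *v e i)) * (if i = j then 1 else 0))"
        unfolding p_def inner_sum_left using orth that by (intro sum.cong) auto
      also have "\<dots> = w \<bullet> (S *v e j)"
        using \<open>finite I\<close> that by (simp add: if_distrib cong: if_cong)
      finally show ?thesis .
    qed
    then have "w - p \<in> V" by (simp add: V_def inner_diff_left)
    moreover have "p \<bullet> (N *v v) = 0" by (simp add: p_def inner_sum_left Ne)
    ultimately show ?thesis using NV[of "w - p"] by (simp add: inner_diff_left)
  qed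
  then have "N *v v = 0" by (metis inner_eq_zero_iff)
  then show thesis
    using v by (intro that[of v m]) (auto simp: Nv V_def)
qed

text \<open>Eigenvectors are added one at a time by induction over subsets of the index type, so
  that the final family can serve as the columns of a square matrix.\<close>

lemma generalized_eigenbasis:
  fixes S C :: "real^'q^'q"
  assumes S: "pos_def_sym S" and C: "transpose C = C"
  obtains e :: "'q \<Rightarrow> real^'q" and l where "\<And>i. C *v e i = l i *\<^sub>R (S *v e i)"
    "\<And>i j. e i \<bullet> (S *v e j) = (if i = j then 1 else 0)"
proof -
  have Ssym: "transpose S = S" using S by (simp add: pos_def_sym_def)
  have "\<exists>(e :: 'q \<Rightarrow> real^'q) l. (\<forall>i\<in>I. C *v e i = l i *\<^sub>R (S *v e i)) \<and>
      (\<forall>i\<in>I. \<forall>j\<in>I. e i \<bullet> (S *v e j) = (if i = j then 1 else 0))" for I :: "'q set"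
    using finite[of I]
  proof (induction I rule: finite_induct)
    case (insert k I)
    then obtain e :: "'q \<Rightarrow> real^'q" and l where
      e: "\<And>i. i \<in> I \<Longrightarrow> C *v e i = l i *\<^sub>R (S *v e i)"
        "\<And>i j. i \<in> I \<Longrightarrow> j \<in> I \<Longrightarrow> e i \<bullet> (S *v e j) = (if i = j then 1 else 0)"
      by metis
    have "card I < CARD('q)"
      using insert.hyps by (intro psubset_card_mono) auto
    from generalized_eigenvector_orthogonal[OF S C insert.hyps(1) this e]
    obtain v m where v: "v \<bullet> (S *v v) = 1" "C *v v = m *\<^sub>R (S *v v)"
        "\<And>i. i \<in> I \<Longrightarrow> v \<bullet> (S *v e i) = 0"
      by metis
    have v': "e i \<bullet> (S *v v) = 0" if "i \<in> I" for i
      using v(3)[OF that] symmetric_matrix_inner[OF Ssym] by metis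
    show ?case
      using insert.hyps e v v'
      by (intro exI[of _ "e(k := v)"] exI[of _ "l(k := m)"]) (auto split: if_splits)
  qed simp
  from this[of UNIV] show thesis using that by auto
qed

section \<open>Trace and determinant\<close>

lemma transpose_mul_mul_nth:
  fixes A M :: "real^'q^'q"
  shows "(transpose M ** A ** M) $ i $ j = column i M \<bullet> (A *v column j M)"
proof -
  have "(transpose M ** (A ** M)) $ i $ j = row i (transpose M) \<bullet> column j (A ** M)"
    by (simp add: matrix_matrix_mult_def row_def column_def inner_vec_def)
  also have "column j (A ** M) = A *v column j M"
    by (simp add: matrix_matrix_mult_def column_def matrix_vector_mult_def)
  finally show ?thesis by (simp add: matrix_mul_assoc)
qed

text \<open>\<open>matrix_inv\<close> is a Hilbert choice, so its equations come from the existence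
  of an inverse.\<close>

lemma matrix_inv_inverse:
  assumes "invertible A"
  shows matrix_inv_right: "A ** matrix_inv A = mat 1"
    and matrix_inv_left: "matrix_inv A ** A = mat 1"
  using assms someI_ex[of "\<lambda>A'. A ** A' = mat 1 \<and> A' ** A = mat 1"]
  unfolding invertible_def matrix_inv_def by auto

lemma matrix_inv_unique:
  fixes A :: "'a::field^'n^'n"
  assumes "A ** X = mat 1"
  shows "matrix_inv A = X"
proof -
  have "invertible A" using assms by (metis invertible_right_inverse)
  then show ?thesis
    using assms by (metis matrix_inv_left matrix_mul_assoc matrix_mul_lid matrix_mul_rid)
qed

text \<open>Congruence by the matrix \<open>M\<close> of generalized eigenvectors takes
  \<open>S\<close> to the identity and \<open>C\<close> to a diagonal matrix. The trace becomes the
  sum of the eigenvalues and the ratio of determinants their product; nonnegativity of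
  \<open>C\<close> makes the eigenvalues admissible for the inequality of the means.\<close>

lemma trace_inverse_mul_ge:
  fixes S C :: "real^'q^'q"
  assumes S: "pos_def_sym S" and C: "transpose C = C" and psd: "\<And>v. 0 \<le> v \<bullet> (C *v v)"
  shows "real CARD('q) * (det C / det S) powr (1 / real CARD('q)) \<le> trace (matrix_inv S ** C)"
proof -
  obtain e :: "'q \<Rightarrow> real^'q" and l where eig: "\<And>i. C *v e i = l i *\<^sub>R (S *v e i)"
    and orth: "\<And>i j. e i \<bullet> (S *v e j) = (if i = j then 1 else 0)"
    using generalized_eigenbasis[OF S C] by metis
  define M :: "real^'q^'q" where "M = (\<chi> a b. e b $ a)"
  define L :: "real^'q^'q" where "L = transpose M ** C ** M"
  have col: "column i M = e i" for i by (simp add: M_def column_def)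
  have MSM: "transpose M ** S ** M = mat 1"
    by (simp add: vec_eq_iff transpose_mul_mul_nth col orth mat_def)
  have L: "L $ i $ j = (if i = j then l i else 0)" for i j
    by (simp add: L_def transpose_mul_mul_nth col eig orth)
  have l: "0 \<le> l i" for i using psd[of "e i"] by (simp add: eig orth)
  \<comment> \<open>One-sided inverses of square matrices are two-sided, so the factors can be
    rotated until \<open>M ** transpose M\<close> appears as the inverse of
    \<open>S\<close>.\<close>
  have "M ** (transpose M ** S) = mat 1"
    using MSM by (metis matrix_left_right_inverse)
  then have "S ** (M ** transpose M) = mat 1"
    by (metis matrix_left_right_inverse matrix_mul_assoc)
  then have inv: "matrix_inv S = M ** transpose M" by (rule matrix_inv_unique)
  have "trace (matrix_inv S ** C) = trace (M ** (transpose M ** C))"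
    by (simp add: inv matrix_mul_assoc)
  also have "\<dots> = trace L" by (subst trace_mul_sym) (simp add: L_def)
  also have "\<dots> = (\<Sum>i\<in>UNIV. l i)" by (simp add: trace_def L)
  finally have tr: "trace (matrix_inv S ** C) = (\<Sum>i\<in>UNIV. l i)" .
  have d1: "det M * det S * det M = 1"
    using arg_cong[OF MSM, of det] by (simp add: det_mul)
  have "det M * det C * det M = det L" by (simp add: L_def det_mul)
  also have "\<dots> = (\<Prod>i\<in>UNIV. l i)" by (subst det_diagonal) (auto simp: L)
  finally have d2: "det M * det C * det M = (\<Prod>i\<in>UNIV. l i)" .
  have "det S \<noteq> 0" using d1 by auto
  then have "det C / det S = (\<Prod>i\<in>UNIV. l i)"
    using d1 d2 by (simp add: field_simps) (metis mult.assoc mult.commute mult.right_neutral)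
  moreover have "(\<Prod>i\<in>UNIV. l i) powr (1 / real CARD('q)) \<le> (\<Sum>i\<in>UNIV. l i / real CARD('q))"
    by (rule arith_geom_mean) (auto simp: l)
  ultimately show ?thesis
    unfolding tr by (simp add: field_simps flip: sum_divide_distrib)
qed

section \<open>The weighted scatter matrix\<close>

lemma outer_mult_vec: "outer r *v v = (r \<bullet> v) *\<^sub>R r"
  by (simp add: outer_def vec_eq_iff matrix_vector_mult_def inner_vec_def sum_distrib_left
      mult.assoc mult.commute mult.left_commute)

lemma wscatter_mult_vec:
  "wscatter n y x B w *v v = (\<Sum>i<n. (w i * (resid (y i) (x i) B \<bullet> v)) *\<^sub>R resid (y i) (x i) B)"
proof -
  have "(\<Sum>i<k. w i *\<^sub>R outer (resid (y i) (x i) B)) *v v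
      = (\<Sum>i<k. (w i * (resid (y i) (x i) B \<bullet> v)) *\<^sub>R resid (y i) (x i) B)" for k
    by (induction k)
      (simp_all add: matrix_vector_mult_add_rdistrib outer_mult_vec flip: scaleR_matrix_vector_assoc)
  then show ?thesis by (simp add: wscatter_def)
qed

lemma transpose_wscatter: "transpose (wscatter n y x B w) = wscatter n y x B w"
  by (simp add: wscatter_def outer_def transpose_def vec_eq_iff mult.commute)

lemma wscatter_inner:
  "v \<bullet> (wscatter n y x B w *v v) = (\<Sum>i<n. w i * (resid (y i) (x i) B \<bullet> v)\<^sup>2)"
  by (simp add: wscatter_mult_vec inner_sum_right power2_eq_square inner_commute mult.assoc)

text \<open>The form at \<open>v\<close> is a weighted sum of squares. If it vanishes, so does each
  term, hence also each term of the matrix applied to \<open>v\<close>, which nonsingularity forbids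
  for \<open>v \<noteq> 0\<close>.\<close>

lemma pos_def_sym_wscatter:
  assumes w: "\<And>i. 0 \<le> w i" and det: "det (wscatter n y x B w) \<noteq> 0"
  shows "pos_def_sym (wscatter n y x B w)"
proof -
  have "0 < v \<bullet> (wscatter n y x B w *v v)" if "v \<noteq> 0" for v
  proof (rule ccontr)
    assume "\<not> 0 < v \<bullet> (wscatter n y x B w *v v)"
    then have "(\<Sum>i<n. w i * (resid (y i) (x i) B \<bullet> v)\<^sup>2) = 0"
      unfolding wscatter_inner
      by (intro antisym sum_nonneg mult_nonneg_nonneg w zero_le_power2) simp
    then have "\<forall>i\<in>{..<n}. w i * (resid (y i) (x i) B \<bullet> v)\<^sup>2 = 0"
      by (subst (asm) sum_nonneg_eq_0_iff) (auto simp: w)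
    then have "wscatter n y x B w *v v = 0"
      unfolding wscatter_mult_vec by (intro sum.neutral) auto
    then show False
      using det that by (metis invertible_det_nz matrix_left_invertible_ker invertible_left_inverse)
  qed
  then show ?thesis by (simp add: pos_def_sym_def transpose_wscatter)
qed

text \<open>By linearity it is enough to treat a single outer product, whose trace against
  \<open>A\<close> is the form of \<open>A\<close> at the residual.\<close>

lemma trace_mul_wscatter:
  "trace (A ** wscatter n y x B w) = (\<Sum>i<n. w i * (resid (y i) (x i) B \<bullet> (A *v resid (y i) (x i) B)))"
proof -
  have 1: "trace (A ** (c *\<^sub>R outer r)) = c * (r \<bullet> (A *v r))" for c and r :: "real^'a"
    by (simp add: trace_def matrix_matrix_mult_def outer_def inner_vec_def matrix_vector_mult_def
        sum_distrib_left ac_simps)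
  have "trace (A ** (\<Sum>i<k. w i *\<^sub>R outer (resid (y i) (x i) B)))
      = (\<Sum>i<k. w i * (resid (y i) (x i) B \<bullet> (A *v resid (y i) (x i) B)))" for k
  proof (induction k)
    case 0
    then show ?case by (simp add: trace_def matrix_matrix_mult_def)
  next
    case (Suc k)
    then show ?case by (simp add: matrix_add_ldistrib trace_add 1)
  qed
  then show ?thesis by (simp add: wscatter_def)
qed

section \<open>Mahalanobis distances\<close>

lemma transpose_matrix_inv:
  fixes S :: "real^'q^'q"
  assumes "invertible S" "transpose S = S"
  shows "transpose (matrix_inv S) = matrix_inv S"
  using assms
  by (metis matrix_inv_left matrix_inv_unique matrix_transpose_mul transpose_mat)

text \<open>Substituting \<open>r = S *v u\<close> turns the form of the inverse at \<open>r\<close>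
  into the form of \<open>S\<close> at \<open>u\<close>. Nonnegativity lets squaring
  \<open>mahal\<close> cancel its square root.\<close>

lemma inner_matrix_inv_nonneg:
  fixes S :: "real^'q^'q"
  assumes "pos_def_sym S"
  shows "0 \<le> r \<bullet> (matrix_inv S *v r)"
proof -
  define u where "u = matrix_inv S *v r"
  have "r = S *v u"
    using matrix_inv_right[OF pos_def_sym_invertible[OF assms]]
    by (simp add: u_def matrix_vector_mul_assoc)
  then have "r \<bullet> (matrix_inv S *v r) = u \<bullet> (S *v u)" by (metis u_def inner_commute)
  then show ?thesis
    using assms by (cases "u = 0") (auto simp: pos_def_sym_def less_imp_le)
qed

lemma mahal_nonneg: "pos_def_sym S \<Longrightarrow> 0 \<le> mahal yi xi B S"
  by (simp add: mahal_def inner_matrix_inv_nonneg)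

lemma weighted_mahal_eq_trace:
  assumes "pos_def_sym S"
  shows "(\<Sum>i<n. w i * (mahal (y i) (x i) B S)\<^sup>2) = trace (matrix_inv S ** wscatter n y x B w)"
  by (simp add: trace_mul_wscatter mahal_def inner_matrix_inv_nonneg[OF assms])

section \<open>Weighted least squares\<close>

lemma resid_add: "resid yi xi (B + D) = resid yi xi B - xi v* D"
  by (simp add: resid_def vector_matrix_mult_add_rdistrib)

text \<open>Along the line \<open>B + t *\<^sub>R D\<close> the objective is quadratic in
  \<open>t\<close> with a minimum at 0, so its linear coefficient vanishes. The direction
  \<open>D\<close> stays arbitrary so that it can later absorb a metric.\<close>

lemma normal_equations:
  fixes B D :: "real^'q^'p"
  assumes min: "\<And>B'. (\<Sum>i<n. w i * (norm (resid (y i) (x i) B))\<^sup>2)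
                   \<le> (\<Sum>i<n. w i * (norm (resid (y i) (x i) B'))\<^sup>2)"
  shows "(\<Sum>i<n. w i * ((x i v* D) \<bullet> resid (y i) (x i) B)) = 0"
proof -
  define b where "b = (\<Sum>i<n. w i * ((x i v* D) \<bullet> resid (y i) (x i) B))"
  define c where "c = (\<Sum>i<n. w i * (norm (x i v* D))\<^sup>2)"
  have "0 \<le> t * (- 2 * b) + t\<^sup>2 * c" for t
  proof -
    have eq: "(norm (resid (y i) (x i) (B + t *\<^sub>R D)))\<^sup>2 = (norm (resid (y i) (x i) B))\<^sup>2
        + (t * (- 2 * ((x i v* D) \<bullet> resid (y i) (x i) B)) + t\<^sup>2 * (norm (x i v* D))\<^sup>2)" for i
    proof -
      have "x i v* (t *\<^sub>R D) = t *\<^sub>R (x i v* D)"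
        by (metis vector_scaleR_matrix_ac scaleR_vector_matrix_assoc)
      then show ?thesis
        unfolding resid_add power2_norm_eq_inner
        by (simp add: inner_diff_left inner_diff_right inner_commute power2_eq_square algebra_simps)
    qed
    have "(\<Sum>i<n. w i * (norm (resid (y i) (x i) (B + t *\<^sub>R D)))\<^sup>2)
        = (\<Sum>i<n. w i * (norm (resid (y i) (x i) B))\<^sup>2) + (t * (- 2 * b) + t\<^sup>2 * c)"
      unfolding eq b_def c_def
      by (simp add: distrib_left right_diff_distrib sum.distrib sum_subtractf sum_distrib_left
          sum_negf mult.left_commute)
    then show ?thesis using min[of "B + t *\<^sub>R D"] by linarith
  qed
  from linear_coeff_eq_0[OF this] show ?thesis by (simp add: b_def)
qed

text \<open>
  The cross term \<open>D\<^sup>T x \<bullet> S\<^sup>-\<^sup>1 r\<close> equals \<open>(D S\<^sup>-\<^sup>1)\<^sup>T x \<bullet> r\<close>, which is again a perturbation covered by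
  the Euclidean normal equations.
\<close>

lemma least_squares_minimizes_mahal:
  fixes B B' :: "real^'q^'p"
  assumes w: "\<And>i. 0 \<le> w i" and S: "pos_def_sym S"
    and min: "\<And>B'. (\<Sum>i<n. w i * (norm (resid (y i) (x i) B))\<^sup>2)
                   \<le> (\<Sum>i<n. w i * (norm (resid (y i) (x i) B'))\<^sup>2)"
  shows "(\<Sum>i<n. w i * (mahal (y i) (x i) B S)\<^sup>2) \<le> (\<Sum>i<n. w i * (mahal (y i) (x i) B' S)\<^sup>2)"
proof -
  define P where "P = matrix_inv S"
  define D where "D = B' - B"
  have P: "transpose P = P"
    using S by (simp add: P_def transpose_matrix_inv pos_def_sym_invertible pos_def_sym_def)
  have mahal_sq: "(mahal (y i) (x i) B'' S)\<^sup>2 = resid (y i) (x i) B'' \<bullet> (P *v resid (y i) (x i) B'')" for i B''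
    by (simp add: mahal_def inner_matrix_inv_nonneg[OF S] P_def)
  have eq: "(mahal (y i) (x i) B' S)\<^sup>2 = (mahal (y i) (x i) B S)\<^sup>2
      - 2 * ((x i v* (D ** P)) \<bullet> resid (y i) (x i) B) + (x i v* D) \<bullet> (P *v (x i v* D))" for i
  proof -
    define r where "r = resid (y i) (x i) B"
    define d where "d = x i v* D"
    have "resid (y i) (x i) B' = r - d"
      using resid_add[of "y i" "x i" B D] by (simp add: D_def r_def d_def)
    moreover have "(x i v* (D ** P)) \<bullet> r = d \<bullet> (P *v r)"
      by (simp add: d_def dot_lmul_matrix flip: vector_matrix_mul_assoc)
    ultimately show ?thesis
      using symmetric_matrix_inner[OF P, of r d]
      by (simp add: mahal_sq flip: r_def d_def)
        (simp add: matrix_vector_mult_diff_distrib inner_diff_left inner_diff_right)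
  qed
  have "(\<Sum>i<n. w i * (mahal (y i) (x i) B' S)\<^sup>2) = (\<Sum>i<n. w i * (mahal (y i) (x i) B S)\<^sup>2)
      - 2 * (\<Sum>i<n. w i * ((x i v* (D ** P)) \<bullet> resid (y i) (x i) B))
      + (\<Sum>i<n. w i * ((x i v* D) \<bullet> (P *v (x i v* D))))"
    unfolding eq by (simp add: sum.distrib sum_subtractf sum_distrib_left algebra_simps)
  \<comment> \<open>Once the cross term is gone, this second-order term is the whole excess of
    \<open>B'\<close> over \<open>B\<close>.\<close>
  moreover have "0 \<le> (\<Sum>i<n. w i * ((x i v* D) \<bullet> (P *v (x i v* D))))"
    by (intro sum_nonneg mult_nonneg_nonneg w) (simp add: P_def inner_matrix_inv_nonneg[OF S])
  ultimately show ?thesis using normal_equations[OF min, of "D ** P"] by simp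
qed

section \<open>Scaling of determinants and matrices\<close>

lemma det_scaleR: "det (c *\<^sub>R (A :: real^'q^'q)) = c ^ CARD('q) * det A"
proof -
  have "c *\<^sub>R A = matrix ((*\<^sub>R) c) ** A"
    by (simp add: matrix_eq matrix_vector_mul_linear flip: matrix_vector_mul_assoc scaleR_matrix_vector_assoc)
  then show ?thesis by (simp add: det_mul)
qed

lemma pos_def_sym_scaleR: "pos_def_sym A \<Longrightarrow> 0 < c \<Longrightarrow> pos_def_sym (c *\<^sub>R A)"
  by (simp add: pos_def_sym_def transpose_scalar flip: scaleR_matrix_vector_assoc)

lemma power_card_powr_inverse:
  assumes "0 < (d::real)" shows "(d ^ CARD('q::finite)) powr (1 / real CARD('q)) = d"
  using assms by (simp add: powr_powr flip: powr_realpow)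

lemma powr_inverse_power_card:
  assumes "0 < (d::real)" shows "(d powr (1 / real CARD('q::finite))) ^ CARD('q) = d"
  using assms by (simp add: powr_realpow[symmetric] powr_powr)

section \<open>Majorization of the loss\<close>

text \<open>The difference \<open>g\<close> of the loss and the parabola with coefficient
  \<open>W u / 2\<close> has derivative \<open>(W t - W u) * t\<close> for positive
  \<open>t\<close>: nonnegative before \<open>u\<close> and nonpositive after it. Hence
  \<open>g\<close> is largest at \<open>u\<close> among nonnegative arguments.\<close>

lemma quadratic_majorant:
  fixes \<rho> W :: "real \<Rightarrow> real"
  assumes diff: "\<And>u. \<rho> differentiable (at u)"
    and W_def: "\<And>u. u \<noteq> 0 \<Longrightarrow> W u = deriv \<rho> u / u"
    and W_mono: "\<And>u v. \<bar>u\<bar> \<le> \<bar>v\<bar> \<Longrightarrow> W v \<le> W u"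
    and uv: "0 \<le> u" "0 \<le> v"
  shows "\<rho> v - \<rho> u \<le> W u * (v\<^sup>2 - u\<^sup>2) / 2"
proof -
  define g where "g t = \<rho> t - W u * t\<^sup>2 / 2" for t
  have g: "(g has_real_derivative (deriv \<rho> t - W u * t)) (at t)" for t
  proof -
    have "(\<rho> has_real_derivative deriv \<rho> t) (at t)"
      using diff[of t] by (metis DERIV_imp_deriv real_differentiable_def)
    then show ?thesis unfolding g_def by (auto intro!: derivative_eq_intros)
  qed
  have cont: "continuous_on A g" for A
    by (intro continuous_at_imp_continuous_on ballI DERIV_isCont[OF g])
  have g': "deriv \<rho> t - W u * t = (W t - W u) * t" if "0 < t" for t
    using W_def[of t] that by (simp add: left_diff_distrib)
  have "g v \<le> g u"
  proof (cases u v rule: linorder_cases)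
    case less
    show ?thesis
    \<comment> \<open>Only interior points matter here, so \<open>t > 0\<close> even when
      \<open>u = 0\<close>, where \<open>W_def\<close> gives no formula for
      \<open>W u\<close>.\<close>
    proof (rule DERIV_nonpos_imp_decreasing_open[OF less_imp_le[OF less] _ cont])
      fix t assume t: "u < t" "t < v"
      then have "(W t - W u) * t \<le> 0"
        using W_mono[of u t] uv by (intro mult_nonpos_nonneg) auto
      then show "\<exists>y. (g has_real_derivative y) (at t) \<and> y \<le> 0"
        using g[of t] g'[of t] t uv by auto
    qed
  next
    case greater
    show ?thesis
    proof (rule DERIV_nonneg_imp_increasing_open[OF less_imp_le[OF greater] _ cont])
      fix t assume t: "v < t" "t < u"
      then have "(W t - W u) * t \<ge> 0"
        using W_mono[of t u] uv by (intro mult_nonneg_nonneg) auto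
      then show "\<exists>y. (g has_real_derivative y) (at t) \<and> 0 \<le> y"
        using g[of t] g'[of t] t uv by auto
    qed
  qed simp
  then show ?thesis by (simp add: g_def algebra_simps diff_divide_distrib)
qed

text \<open>At positive arguments the sign of \<open>W\<close> is that of the derivative of a
  nondecreasing function. Every other \<open>u\<close> is compared with the positive point
  \<open>\<bar>u\<bar> + 1\<close>, where \<open>W\<close> is at most \<open>W u\<close>.\<close>

lemma rho_function_weight_nonneg:
  assumes rho: "rho_function \<rho>" and diff: "\<And>u. \<rho> differentiable (at u)"
    and W_def: "\<And>u. u \<noteq> 0 \<Longrightarrow> W u = deriv \<rho> u / u"
    and W_mono: "\<And>u v. \<bar>u\<bar> \<le> \<bar>v\<bar> \<Longrightarrow> W v \<le> W u"
  shows "0 \<le> W u"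
proof -
  have *: "0 \<le> W t" if t: "0 < t" for t
  proof -
    have "(\<rho> has_real_derivative deriv \<rho> t) (at t)"
      using diff[of t] by (metis DERIV_imp_deriv real_differentiable_def)
    moreover have "mono_on {0<..} \<rho>"
      using rho by (auto simp: rho_function_def mono_on_def)
    ultimately have "0 \<le> deriv \<rho> t"
      using t by (intro mono_on_imp_deriv_nonneg[of "{0<..}" \<rho>]) (auto simp: interior_open)
    then show ?thesis using W_def[of t] t by simp
  qed
  then show ?thesis using W_mono[of u "\<bar>u\<bar> + 1"] *[of "\<bar>u\<bar> + 1"] by linarith
qed

text \<open>This is the equality case of the trace inequality, with \<open>S\<close> proportional to
  \<open>C\<close>.\<close>

lemma trace_inverse_scaleR_mul:
  fixes C :: "real^'q^'q"
  assumes C: "pos_def_sym C" and c: "0 < c"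
  shows "trace (matrix_inv (c *\<^sub>R C) ** C) = real CARD('q) / c"
proof -
  have "(c *\<^sub>R C) ** ((1 / c) *\<^sub>R matrix_inv C) = mat 1"
    using c matrix_inv_right[OF pos_def_sym_invertible[OF C]]
    by (simp add: matrix_scalar_ac flip: scalar_matrix_assoc)
  then have "matrix_inv (c *\<^sub>R C) = (1 / c) *\<^sub>R matrix_inv C" by (rule matrix_inv_unique)
  then have "matrix_inv (c *\<^sub>R C) ** C = (1 / c) *\<^sub>R mat 1"
    using matrix_inv_left[OF pos_def_sym_invertible[OF C]]
    by (simp flip: scalar_matrix_assoc)
  then show ?thesis by (simp add: trace_def mat_def)
qed

section \<open>Descent of the iteration\<close>

theorem theorem7:
  fixes n :: nat
    and y :: "nat \<Rightarrow> real^'q" and x :: "nat \<Rightarrow> real^'p"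
    and \<rho>1 W :: "real \<Rightarrow> real" and \<sigma> :: real
    and B :: "nat \<Rightarrow> real^'q^'p" and \<Sigma> :: "nat \<Rightarrow> real^'q^'q"
    and \<Gamma>0 :: "real^'q^'q"
  assumes rho: "rho_function \<rho>1"
    and diff: "\<And>u. \<rho>1 differentiable (at u)"
    and W_def: "\<And>u. u \<noteq> 0 \<Longrightarrow> W u = deriv \<rho>1 u / u"
    and W_mono: "\<And>u v. \<bar>u\<bar> \<le> \<bar>v\<bar> \<Longrightarrow> W v \<le> W u"
    and sigma_pos: "\<sigma> > 0"
    and Gamma0: "pos_def_sym \<Gamma>0" "det \<Gamma>0 = 1"
    and Sigma0: "\<Sigma> 0 = \<sigma>\<^sup>2 *\<^sub>R \<Gamma>0"
    and B_step: "\<And>k B'. (\<Sum>i<n. W (mahal (y i) (x i) (B k) (\<Sigma> k)) * (norm (resid (y i) (x i) (B (Suc k))))\<^sup>2)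
                   \<le> (\<Sum>i<n. W (mahal (y i) (x i) (B k) (\<Sigma> k)) * (norm (resid (y i) (x i) B'))\<^sup>2)"
    and C_nondeg: "\<And>k. det (wscatter n y x (B (Suc k)) (\<lambda>i. W (mahal (y i) (x i) (B k) (\<Sigma> k)))) > 0"
    and Sigma_step: "\<And>k. \<Sigma> (Suc k) =
          (\<sigma>\<^sup>2 / (det (wscatter n y x (B (Suc k)) (\<lambda>i. W (mahal (y i) (x i) (B k) (\<Sigma> k))))
                  powr (1 / real CARD('q))))
          *\<^sub>R wscatter n y x (B (Suc k)) (\<lambda>i. W (mahal (y i) (x i) (B k) (\<Sigma> k)))"
  shows "\<And>k. (\<Sum>i<n. \<rho>1 (mahal (y i) (x i) (B (Suc k)) (\<Sigma> (Suc k))))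
             \<le> (\<Sum>i<n. \<rho>1 (mahal (y i) (x i) (B k) (\<Sigma> k)))"
proof -
  fix k
  define w where "w j = (\<lambda>i. W (mahal (y i) (x i) (B j) (\<Sigma> j)))" for j
  define C where "C j = wscatter n y x (B (Suc j)) (w j)" for j
  define c where "c j = \<sigma>\<^sup>2 / (det (C j) powr (1 / real CARD('q)))" for j
  have w: "0 \<le> w j i" for j i
    unfolding w_def by (rule rho_function_weight_nonneg[OF rho diff W_def W_mono])
  have detC: "0 < det (C j)" for j
    using C_nondeg[of j] by (simp add: C_def w_def)
  have C: "pos_def_sym (C j)" for j
    using detC[of j] w unfolding C_def by (intro pos_def_sym_wscatter) auto
  have c: "0 < c j" for j
    using sigma_pos detC[of j] by (simp add: c_def)
  have Sigma_Suc: "\<Sigma> (Suc j) = c j *\<^sub>R C j" for j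
    using Sigma_step[of j] by (simp add: C_def c_def w_def)
  have PD: "pos_def_sym (\<Sigma> j)" for j
    using Sigma0 Gamma0 sigma_pos
    by (cases j) (auto simp: Sigma_Suc C c intro!: pos_def_sym_scaleR)
  \<comment> \<open>The normalization keeps the determinant constant along the iteration, so the old
    and the new scatter matrix compete at equal determinant.\<close>
  have detS: "det (\<Sigma> j) = (\<sigma>\<^sup>2) ^ CARD('q)" for j
  proof (cases j)
    case 0
    then show ?thesis by (simp add: Sigma0 det_scaleR Gamma0)
  next
    case (Suc i)
    then show ?thesis
      using powr_inverse_power_card[OF detC[of i], where 'q='q] detC[of i]
      by (simp add: Sigma_Suc det_scaleR c_def power_divide)
  qed
  \<comment> \<open>The lower bound for the trace at \<open>\<Sigma> k\<close> is therefore exactly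
    the value attained at \<open>\<Sigma> (Suc k)\<close>.\<close>
  have root: "(det (C k) / det (\<Sigma> k)) powr (1 / real CARD('q)) = 1 / c k"
  proof -
    have "((\<sigma>\<^sup>2) ^ CARD('q)) powr (1 / real CARD('q)) = \<sigma>\<^sup>2"
      using sigma_pos by (intro power_card_powr_inverse) simp
    then show ?thesis
      using detC[of k] by (simp add: detS powr_divide c_def)
  qed
  \<comment> \<open>The chain passes from the new pair back to the old one: first \<Sigma> changes
    with \<open>B (Suc k)\<close> fixed, then \<open>B\<close> changes in the metric of
    \<open>\<Sigma> k\<close>. The weights are those of step \<open>k\<close> throughout.\<close>
  have "(\<Sum>i<n. w k i * (mahal (y i) (x i) (B (Suc k)) (\<Sigma> (Suc k)))\<^sup>2)
      = trace (matrix_inv (\<Sigma> (Suc k)) ** C k)"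
    by (simp add: weighted_mahal_eq_trace PD C_def)
  also have "\<dots> = real CARD('q) / c k"
    by (simp add: Sigma_Suc trace_inverse_scaleR_mul C c)
  also have "\<dots> \<le> trace (matrix_inv (\<Sigma> k) ** C k)"
  proof -
    have "0 \<le> v \<bullet> (C k *v v)" for v
      using C[of k] by (cases "v = 0") (auto simp: pos_def_sym_def less_imp_le)
    moreover have "transpose (C k) = C k" using C[of k] by (simp add: pos_def_sym_def)
    ultimately show ?thesis using trace_inverse_mul_ge[OF PD[of k], of "C k"] by (simp add: root)
  qed
  also have "\<dots> = (\<Sum>i<n. w k i * (mahal (y i) (x i) (B (Suc k)) (\<Sigma> k))\<^sup>2)"
    by (simp add: weighted_mahal_eq_trace PD C_def)
  also have "\<dots> \<le> (\<Sum>i<n. w k i * (mahal (y i) (x i) (B k) (\<Sigma> k))\<^sup>2)"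
    using B_step[of k] by (intro least_squares_minimizes_mahal w PD) (simp add: w_def)
  finally have descent: "(\<Sum>i<n. w k i * (mahal (y i) (x i) (B (Suc k)) (\<Sigma> (Suc k)))\<^sup>2)
      \<le> (\<Sum>i<n. w k i * (mahal (y i) (x i) (B k) (\<Sigma> k))\<^sup>2)" .
  \<comment> \<open>Each parabola is anchored at the old distance, whose weight is
    \<open>w k i\<close>.\<close>
  have "(\<Sum>i<n. \<rho>1 (mahal (y i) (x i) (B (Suc k)) (\<Sigma> (Suc k))) - \<rho>1 (mahal (y i) (x i) (B k) (\<Sigma> k)))
      \<le> (\<Sum>i<n. w k i * ((mahal (y i) (x i) (B (Suc k)) (\<Sigma> (Suc k)))\<^sup>2
            - (mahal (y i) (x i) (B k) (\<Sigma> k))\<^sup>2) / 2)"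
    unfolding w_def
    by (intro sum_mono quadratic_majorant[OF diff W_def W_mono] mahal_nonneg PD)
  also have "\<dots> = ((\<Sum>i<n. w k i * (mahal (y i) (x i) (B (Suc k)) (\<Sigma> (Suc k)))\<^sup>2)
      - (\<Sum>i<n. w k i * (mahal (y i) (x i) (B k) (\<Sigma> k))\<^sup>2)) / 2"
    by (simp add: sum_subtractf right_diff_distrib flip: sum_divide_distrib)
  also have "\<dots> \<le> 0" using descent by simp
  finally show "(\<Sum>i<n. \<rho>1 (mahal (y i) (x i) (B (Suc k)) (\<Sigma> (Suc k))))
      \<le> (\<Sum>i<n. \<rho>1 (mahal (y i) (x i) (B k) (\<Sigma> k)))"
    by (simp add: sum_subtractf)
qed

end
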